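(* Assume $2^{\aleph_0}=2^{\aleph_1}$ and $\aleph_1<\mathfrak{d}$. Let $X=L\cup(\omega_1\times\omega)$ be the space constructed in the context (from a set $L$ of cardinality $\aleph_1$, a strongly independent family of size $2^{\aleph_0}$ on $\omega$, and a complement-preserving bijection $f$). Then $X$ is normal and star-Menger, but $X$ is not strongly star-Menger and $X$ is not a Dowker space.
   Context: **Independent families.** A family $\mathcal{F}\subseteq\mathcal{P}(\omega)$ is strongly independent if for all disjoint finite $F,G\subseteq\mathcal{F}$ the set $\bigcap_{A\in F}A\cap\bigcap_{A\in G}(\omega\setminus A)$ is infinite (with $\bigcap\emptyset=\omega$). Such families of size $\mathfrak{c}=2^{\aleph_0}$ exist. **The space $X_0$.** Let $L$ be a set of cardinality $\aleph_1$, disjoint from $\omega$ (and from $\omega_1\times\omega$). Let $\mathcal{F}=\{A_\alpha:\alpha<\mathfrak{c}\}$ be a strongly independent family of subsets of $\omega$ of size $\mathfrak{c}$. Using $2^{\aleph_0}=2^{\aleph_1}$, let $f:\mathcal{P}(L)\to\{A_\alpha:\alpha<\mathfrak{c}\}\cup\{\omega\setminus A_\alpha:\alpha<\mathfrak{c}\}$ be a bijection with $f(L\setminus B)=\omega\setminus f(B)$ for every $B\subseteq L$. Let $X_0=L\cup\omega$ have the topology with subbase consisting of: all sets $M\cup f(M)$ for $M\subseteq L$; all singletons $\{n\}$ for $n\in\omega$; and all sets $X_0\setminus\{p\}$ for $p\in X_0$. **The space $X$.** Let $X=L\cup(\omega_1\times\omega)$, with the topology in which: - basic open neighbourhoods of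 $x\in L$ are the sets $V^U_\alpha(x)=(U\cap L)\cup\big((\alpha,\omega_1)\times(U\cap\omega)\big)$, where $U$ is an open neighbourhood of $x$ in $X_0$ and $\alpha<\omega_1$; - basic open neighbourhoods of $\langle\alpha,n\rangle\in\omega_1\times\omega$ are the sets $W\times\{n\}$, where $W$ is an open neighbourhood of $\alpha$ in $\omega_1$ with the order topology. **Properties.** Normal spaces are assumed $T_1$. For a family $\mathcal{U}$ of subsets of $X$ and $A\subseteq X$, $St(A,\mathcal{U})=\bigcup\{U\in\mathcal{U}:U\cap A\neq\emptyset\}$. $X$ is star-Menger if for each sequence $\{\mathcal{U}_n:n\in\omega\}$ of open covers of $X$ there are finite $\mathcal{V}_n\subseteq\mathcal{U}_n$ such that $\{St(\bigcup\mathcal{V}_n,\mathcal{U}_n):n\in\omega\}$ covers $X$; $X$ is strongly star-Menger if for each such sequence there are finite $F_n\subseteq X$ such that $\{St(F_n,\mathcal{U}_n):n\in\omega\}$ covers $X$. A Dowker space is a normal space whose product with the closed unit interval is not normal (equivalently, a normal space that is not countably paracompact). $\mathfrak{d}$ is the least cardinality of a set $D\subseteq\omega^\omega$ such that every $g\in\omega^\omega$ satisfies $g\leq^* h$ for some $h\in D$, where $g\leq^* h$ means $g(n)\leq h(n)$ for all but finitely many $n$. *)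

theory Defs
  imports "HOL-Analysis.Analysis"
begin

unbundle cardinal_syntax

section \<open>The ordinal \<open>\<omega>\<^sub>1\<close>\<close>

abbreviation aleph1 :: "nat set rel"
  where "aleph1 \<equiv> cardSuc natLeq"

lemma Card_order_aleph1: "Card_order aleph1"
  by (simp add: cardSuc_Card_order natLeq_Card_order)

text \<open>\<open>aleph1\<close> is itself a well-order of the least uncountable order type; \<open>omega1\<close> turns it into
  a type, so that the order topology on \<open>\<omega>\<^sub>1\<close> is that of the class \<open>linorder_topology\<close>.\<close>

typedef omega1 = "Field aleph1"
proof -
  have "infinite (Field aleph1)"
    unfolding cardSuc_finite[OF natLeq_Card_order] Field_natLeq by simp
  then show ?thesis
    by (metis ex_in_conv finite.emptyI)
qed

instantiation omega1 :: wellorder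
begin

definition less_eq_omega1 :: "omega1 \<Rightarrow> omega1 \<Rightarrow> bool"
  where "a \<le> b \<longleftrightarrow> (Rep_omega1 a, Rep_omega1 b) \<in> aleph1"

definition less_omega1 :: "omega1 \<Rightarrow> omega1 \<Rightarrow> bool"
  where "a < (b :: omega1) \<longleftrightarrow> a \<le> b \<and> a \<noteq> b"

instance
proof
  interpret wo_rel aleph1
    by (rule Card_order_wo_rel[OF Card_order_aleph1])
  fix x y z :: omega1
  show refl': "x \<le> x"
    unfolding less_eq_omega1_def using refl_onD[OF REFL Rep_omega1] .
  show "x \<le> y \<Longrightarrow> y \<le> z \<Longrightarrow> x \<le> z"
    unfolding less_eq_omega1_def by (rule transD[OF TRANS])
  show anti: "x \<le> y \<Longrightarrow> y \<le> x \<Longrightarrow> x = y"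
    unfolding less_eq_omega1_def using antisymD[OF ANTISYM] Rep_omega1_inject[of x y] by blast
  show "x < y \<longleftrightarrow> x \<le> y \<and> \<not> y \<le> x"
    unfolding less_omega1_def using anti refl' by blast
  show "x \<le> y \<or> y \<le> x"
    unfolding less_eq_omega1_def using TOTALS Rep_omega1[of x] Rep_omega1[of y] by blast
  fix P :: "omega1 \<Rightarrow> bool" and a
  assume step: "\<And>x. (\<And>y. y < x \<Longrightarrow> P y) \<Longrightarrow> P x"
  have "wf (inv_image (aleph1 - Id) Rep_omega1)"
    using WF by (rule wf_inv_image)
  then show "P a"
  proof (induction a rule: wf_induct_rule)
    case (less a)
    show ?case
    proof (rule step)
      fix y assume "y < a"
      then have "(y, a) \<in> inv_image (aleph1 - Id) Rep_omega1"
        unfolding less_omega1_def less_eq_omega1_def by (simp add: Rep_omega1_inject)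
      then show "P y"
        by (rule less)
    qed
  qed
qed

end

instantiation omega1 :: linorder_topology
begin

definition open_omega1 :: "omega1 set \<Rightarrow> bool"
  where "open_omega1 = generate_topology (range (\<lambda>a. {..<a}) \<union> range (\<lambda>a. {a<..}))"

instance
  by standard (rule open_omega1_def)

end

lemma bij_betw_Rep_omega1: "bij_betw Rep_omega1 UNIV (Field aleph1)"
  using type_definition.Rep_range[OF type_definition_omega1] Rep_omega1_inject
  by (auto simp: bij_betw_def inj_on_def)

lemma card_of_omega1: "|UNIV :: omega1 set| =o aleph1"
  using card_of_ordIso[of "UNIV :: omega1 set" "Field aleph1"] bij_betw_Rep_omega1
    card_of_Field_ordIso[OF Card_order_aleph1] ordIso_transitive by blast

lemma countable_lessThan_omega1: "countable {..<a :: omega1}"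
proof -
  have "|underS aleph1 (Rep_omega1 a)| <o aleph1"
    using card_of_underS[OF Card_order_aleph1 Rep_omega1] .
  then have le: "|underS aleph1 (Rep_omega1 a)| \<le>o natLeq"
    using cardSuc_ordLeq_ordLess[OF natLeq_Card_order card_of_Card_order] by blast
  have "countable (underS aleph1 (Rep_omega1 a))"
    using ordLeq_ordIso_trans[OF le ordIso_symmetric[OF card_of_nat]]
    by (auto simp: countable_def simp flip: card_of_ordLeq)
  moreover have "Rep_omega1 ` {..<a} \<subseteq> underS aleph1 (Rep_omega1 a)"
    by (auto simp: underS_def less_omega1_def less_eq_omega1_def Rep_omega1_inject)
  ultimately show ?thesis
    by (meson Rep_omega1_inject countable_image_inj_on countable_subset inj_onI)
qed


section \<open>The dominating number\<close>

definition le_star :: "(nat \<Rightarrow> nat) \<Rightarrow> (nat \<Rightarrow> nat) \<Rightarrow> bool"  (infix \<open>\<le>\<^sup>*\<close> 50)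
  where "g \<le>\<^sup>* h \<longleftrightarrow> finite {n. \<not> g n \<le> h n}"

definition dominating :: "(nat \<Rightarrow> nat) set \<Rightarrow> bool"
  where "dominating D \<longleftrightarrow> (\<forall>g. \<exists>h\<in>D. g \<le>\<^sup>* h)"

definition dominating_number :: "(nat \<Rightarrow> nat) rel"  (\<open>\<dd>\<close>)
  where "\<dd> = |SOME D. dominating D \<and> (\<forall>D'. dominating D' \<longrightarrow> |D| \<le>o |D'| )|"

lemma dominating_number:
  obtains D where "dominating D" "\<dd> = |D|" "\<And>D'. dominating D' \<Longrightarrow> \<dd> \<le>o |D'|"
proof -
  have "dominating UNIV"
    unfolding dominating_def le_star_def by (metis (mono_tags) UNIV_I empty_Collect_eq finite.emptyI order_refl)
  then have "card_of ` Collect dominating \<noteq> {}"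
    by blast
  then have "\<exists>D. dominating D \<and> (\<forall>D'. dominating D' \<longrightarrow> |D| \<le>o |D'| )"
    using exists_minim_Card_order[of "card_of ` Collect dominating"] card_of_Card_order by blast
  then show thesis
    using that[OF _ dominating_number_def] someI_ex[of "\<lambda>D. dominating D \<and> (\<forall>D'. dominating D' \<longrightarrow> |D| \<le>o |D'| )"]
    unfolding dominating_number_def by blast
qed


section \<open>The space\<close>

definition strongly_independent :: "nat set set \<Rightarrow> bool"
  where "strongly_independent \<A> \<longleftrightarrow>
    (\<forall>F G. finite F \<and> finite G \<and> F \<subseteq> \<A> \<and> G \<subseteq> \<A> \<and> F \<inter> G = {} \<longrightarrow>
      infinite (\<Inter>F \<inter> (\<Inter>A\<in>G. - A)))"

text \<open>The disjoint unions \<open>L \<union> \<omega>\<close> and \<open>L \<union> (\<omega>\<^sub>1 \<times> \<omega>)\<close> are taken in sum types.\<close>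

definition X0_points :: "'l set \<Rightarrow> ('l + nat) set"
  where "X0_points L = L <+> UNIV"

definition X0_space :: "'l set \<Rightarrow> ('l set \<Rightarrow> nat set) \<Rightarrow> ('l + nat) topology"
  where "X0_space L f = topology_generated_by
    ({M <+> f M | M. M \<subseteq> L} \<union> range (\<lambda>n. {Inr n}) \<union> {X0_points L - {p} | p. p \<in> X0_points L})"

definition L_nbhd :: "('l + nat) set \<Rightarrow> omega1 \<Rightarrow> ('l + omega1 \<times> nat) set"
  where "L_nbhd U \<alpha> = (Inl -` U) <+> ({\<alpha><..} \<times> (Inr -` U))"

text \<open>The basic neighbourhoods are taken together as a subbase. They are neighbourhood bases of the
  resulting topology, see \<open>openin_X_space_iff\<close>.\<close>

definition X_space :: "'l set \<Rightarrow> ('l set \<Rightarrow> nat set) \<Rightarrow> ('l + omega1 \<times> nat) topology"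
  where "X_space L f = topology_generated_by
    ({L_nbhd U \<alpha> | U \<alpha>. openin (X0_space L f) U \<and> (\<exists>x\<in>L. Inl x \<in> U)} \<union>
     {Inr ` (W \<times> {n}) | W n. open W \<and> W \<noteq> {}})"

lemma topspace_X0_space: "topspace (X0_space L f) = X0_points L"
  by (auto simp: X0_space_def X0_points_def)

lemma topspace_X_space: "topspace (X_space L f) = L <+> UNIV"
proof
  have *: "Inl -` U \<subseteq> L" if "openin (X0_space L f) U" for U
    using openin_subset[OF that] by (auto simp: topspace_X0_space X0_points_def)
  show "topspace (X_space L f) \<subseteq> L <+> UNIV"
    using * by (fastforce simp: X_space_def L_nbhd_def)
  have 1: "Inl x \<in> topspace (X_space L f)" if "x \<in> L" for x
  proof -
    have "openin (X_space L f) (L_nbhd (topspace (X0_space L f)) undefined)"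
      unfolding X_space_def
    proof (rule topology_generated_by_Basis)
      have "Inl x \<in> topspace (X0_space L f)"
        using that by (auto simp: topspace_X0_space X0_points_def)
      then show "L_nbhd (topspace (X0_space L f)) undefined \<in>
        {L_nbhd U \<alpha> | U \<alpha>. openin (X0_space L f) U \<and> (\<exists>x\<in>L. Inl x \<in> U)} \<union>
        {Inr ` (W \<times> {n}) | W n. open W \<and> W \<noteq> {}}"
        using that openin_topspace by blast
    qed
    then show ?thesis
      using that by (auto simp: L_nbhd_def topspace_X0_space X0_points_def dest!: openin_subset)
  qed
  have 2: "Inr (\<alpha>, n) \<in> topspace (X_space L f)" for \<alpha> n
  proof -
    have "openin (X_space L f) (Inr ` (UNIV \<times> {n}))"
      unfolding X_space_def by (rule topology_generated_by_Basis) (use open_UNIV in blast)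
    then show ?thesis
      by (auto dest!: openin_subset)
  qed
  show "L <+> UNIV \<subseteq> topspace (X_space L f)"
    using 1 2 by auto
qed

lemma openin_X_space_iff:
  "openin (X_space L f) S \<longleftrightarrow> S \<subseteq> L <+> UNIV \<and>
    (\<forall>x\<in>L. Inl x \<in> S \<longrightarrow> (\<exists>U \<alpha>. openin (X0_space L f) U \<and> Inl x \<in> U \<and> L_nbhd U \<alpha> \<subseteq> S)) \<and>
    (\<forall>\<alpha> n. Inr (\<alpha>, n) \<in> S \<longrightarrow> (\<exists>W. open W \<and> \<alpha> \<in> W \<and> Inr ` (W \<times> {n}) \<subseteq> S))"
  (is "_ \<longleftrightarrow> _ \<and> ?P S \<and> ?Q S")
proof
  assume S: "openin (X_space L f) S"
  then have "generate_topology_on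
    ({L_nbhd U \<alpha> | U \<alpha>. openin (X0_space L f) U \<and> (\<exists>x\<in>L. Inl x \<in> U)} \<union>
     {Inr ` (W \<times> {n}) | W n. open W \<and> W \<noteq> {}}) S"
    by (simp add: X_space_def openin_topology_generated_by_iff)
  then have "?P S \<and> ?Q S"
  proof induction
    case Empty
    then show ?case by simp
  next
    case (Int A B)
    have "?P (A \<inter> B)"
    proof (intro ballI impI)
      fix x assume x: "x \<in> L" "Inl x \<in> A \<inter> B"
      obtain U \<alpha> where U: "openin (X0_space L f) U" "Inl x \<in> U" "L_nbhd U \<alpha> \<subseteq> A"
        using Int x by blast
      obtain U' \<alpha>' where U': "openin (X0_space L f) U'" "Inl x \<in> U'" "L_nbhd U' \<alpha>' \<subseteq> B"
        using Int x by blast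
      have "L_nbhd (U \<inter> U') (max \<alpha> \<alpha>') \<subseteq> L_nbhd U \<alpha> \<inter> L_nbhd U' \<alpha>'"
        by (auto simp: L_nbhd_def)
      then show "\<exists>U \<alpha>. openin (X0_space L f) U \<and> Inl x \<in> U \<and> L_nbhd U \<alpha> \<subseteq> A \<inter> B"
        using U U' openin_Int[OF U(1) U'(1)] by blast
    qed
    moreover have "?Q (A \<inter> B)"
    proof (intro allI impI)
      fix \<alpha> n assume "Inr (\<alpha>, n) \<in> A \<inter> B"
      then obtain W W' where "open W" "\<alpha> \<in> W" "Inr ` (W \<times> {n}) \<subseteq> A"
        "open W'" "\<alpha> \<in> W'" "Inr ` (W' \<times> {n}) \<subseteq> B"
        using Int by blast
      then show "\<exists>W. open W \<and> \<alpha> \<in> W \<and> Inr ` (W \<times> {n}) \<subseteq> A \<inter> B"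
        by (intro exI[of _ "W \<inter> W'"]) auto
    qed
    ultimately show ?case ..
  next
    case (UN K)
    have "?P (\<Union>K)"
    proof (intro ballI impI)
      fix x assume "x \<in> L" "Inl x \<in> \<Union>K"
      then obtain k where "k \<in> K" "Inl x \<in> k" by blast
      then show "\<exists>U \<alpha>. openin (X0_space L f) U \<and> Inl x \<in> U \<and> L_nbhd U \<alpha> \<subseteq> \<Union>K"
        using UN(2)[OF \<open>k \<in> K\<close>] \<open>x \<in> L\<close> by (meson Union_upper subset_trans)
    qed
    moreover have "?Q (\<Union>K)"
    proof (intro allI impI)
      fix \<alpha> n assume "Inr (\<alpha>, n) \<in> \<Union>K"
      then obtain k where "k \<in> K" "Inr (\<alpha>, n) \<in> k" by blast
      then show "\<exists>W. open W \<and> \<alpha> \<in> W \<and> Inr ` (W \<times> {n}) \<subseteq> \<Union>K"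
        using UN(2)[OF \<open>k \<in> K\<close>] by (meson Union_upper subset_trans)
    qed
    ultimately show ?case ..
  next
    case (Basis s)
    then consider U \<alpha> where "s = L_nbhd U \<alpha>" "openin (X0_space L f) U"
      | W n where "s = Inr ` (W \<times> {n})" "open W"
      by blast
    then show ?case
    proof cases
      case 1
      have "?Q s"
      proof (intro allI impI)
        fix \<beta> n assume "Inr (\<beta>, n) \<in> s"
        then show "\<exists>W. open W \<and> \<beta> \<in> W \<and> Inr ` (W \<times> {n}) \<subseteq> s"
          by (intro exI[of _ "{\<alpha><..}"]) (auto simp: 1 L_nbhd_def)
      qed
      moreover have "?P s"
        using 1 by (auto simp: L_nbhd_def)
      ultimately show ?thesis by blast
    next
      case 2
      then show ?thesis by blast
    qed
  qed
  then show "S \<subseteq> L <+> UNIV \<and> ?P S \<and> ?Q S"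
    using openin_subset[OF S] by (simp add: topspace_X_space)
next
  assume S: "S \<subseteq> L <+> UNIV \<and> ?P S \<and> ?Q S"
  show "openin (X_space L f) S"
  proof (subst openin_subopen, intro ballI)
    fix p assume p: "p \<in> S"
    show "\<exists>T. openin (X_space L f) T \<and> p \<in> T \<and> T \<subseteq> S"
    proof (cases p)
      case (Inl x)
      then have "x \<in> L" using S p by blast
      then obtain U \<alpha> where U: "openin (X0_space L f) U" "Inl x \<in> U" "L_nbhd U \<alpha> \<subseteq> S"
        using S p Inl by blast
      have "openin (X_space L f) (L_nbhd U \<alpha>)"
        unfolding X_space_def by (rule topology_generated_by_Basis) (use U \<open>x \<in> L\<close> in blast)
      then show ?thesis
        using U Inl by (auto simp: L_nbhd_def)
    next
      case (Inr q)
      obtain \<alpha> n where q: "q = (\<alpha>, n)" by fastforce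
      then obtain W where W: "open W" "\<alpha> \<in> W" "Inr ` (W \<times> {n}) \<subseteq> S"
        using S p Inr by blast
      have "openin (X_space L f) (Inr ` (W \<times> {n}))"
        unfolding X_space_def by (rule topology_generated_by_Basis) (use W in blast)
      then show ?thesis
        using W Inr q by blast
    qed
  qed
qed


section \<open>Covering properties\<close>

text \<open>The library's \<open>normal_space\<close> does not include the \<open>T\<^sub>1\<close> axiom.\<close>

definition normal_T1_space :: "'a topology \<Rightarrow> bool"
  where "normal_T1_space X \<longleftrightarrow> normal_space X \<and> t1_space X"

definition Dowker_space :: "'a topology \<Rightarrow> bool"
  where "Dowker_space X \<longleftrightarrow> normal_T1_space X \<and>
    \<not> normal_T1_space (prod_topology X (top_of_set {0..1 :: real}))"

definition open_cover :: "'a topology \<Rightarrow> 'a set set \<Rightarrow> bool"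
  where "open_cover X \<U> \<longleftrightarrow> (\<forall>U\<in>\<U>. openin X U) \<and> \<Union>\<U> = topspace X"

definition St :: "'a set \<Rightarrow> 'a set set \<Rightarrow> 'a set"
  where "St A \<U> = \<Union>{U \<in> \<U>. U \<inter> A \<noteq> {}}"

definition star_Menger :: "'a topology \<Rightarrow> bool"
  where "star_Menger X \<longleftrightarrow>
    (\<forall>\<U> :: nat \<Rightarrow> 'a set set. (\<forall>n. open_cover X (\<U> n)) \<longrightarrow>
      (\<exists>\<V>. (\<forall>n. finite (\<V> n) \<and> \<V> n \<subseteq> \<U> n) \<and> (\<Union>n. St (\<Union>(\<V> n)) (\<U> n)) = topspace X))"

definition strongly_star_Menger :: "'a topology \<Rightarrow> bool"
  where "strongly_star_Menger X \<longleftrightarrow>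
    (\<forall>\<U> :: nat \<Rightarrow> 'a set set. (\<forall>n. open_cover X (\<U> n)) \<longrightarrow>
      (\<exists>F. (\<forall>n. finite (F n) \<and> F n \<subseteq> topspace X) \<and> (\<Union>n. St (F n) (\<U> n)) = topspace X))"

end

theory Submission
  imports Defs
begin

text \<open>Write \<open>X\<close> for the space and \<open>I\<close> for the unit interval.

  \<^item> \<^emph>\<open>Normality of \<open>X\<close> and of \<open>X \<times> I\<close>.\<close> Both follow from one property of \<open>X\<close>: for open sets \<open>U\<^sub>0,
    U\<^sub>1, \<dots>\<close> covering \<open>X\<close> there is a locally constant \<open>\<Phi> : X \<rightarrow> \<nat>\<close> with \<open>p \<in> U\<^bsub>\<Phi> p\<^esub>\<close> for all \<open>p\<close>
    (\<open>locally_constant_choices_X\<close>). Over a point of \<open>X\<close> two disjoint closed subsets of \<open>X \<times> I\<close> are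
    separated by one of countably many pairs of disjoint open subsets of \<open>I\<close>; by compactness of
    \<open>I\<close> the same pair works for all nearby points, and \<open>\<Phi>\<close> selects a pair for each point so that
    the chosen pairs fit together (\<open>normal_prod_compact\<close>). On \<open>L\<close> the function \<open>\<Phi>\<close> may be any
    choice of indices: the code \<open>f\<close> makes every subset of \<open>L\<close> the trace of a clopen set, so every
    partition of \<open>L\<close> into countably many pieces extends to a neighbourhood of \<open>L\<close> in \<open>X\<^sub>0\<close>
    (\<open>extend_partition_to_X0\<close>). On a column \<open>\<omega>\<^sub>1 \<times> {n}\<close> one of the sets \<open>U\<^sub>i\<close> contains a tail
    (\<open>countable_cover_contains_tail\<close>), and the countable zero-dimensional rest poses no problem.

  \<^item> \<^emph>\<open>Star-Menger.\<close> Every column is contained in the star of a finite set, so the \<open>n\<close>-th cover can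
    take care of the \<open>n\<close>-th column. By strong independence every neighbourhood of a point \<open>x \<in> L\<close>
    contains a tail of some column. Let \<open>m\<^sub>x(n)\<close> be a column of which some member of the \<open>n\<close>-th
    cover containing \<open>x\<close> contains a tail. Since \<open>\<aleph>\<^sub>1 < \<dd>\<close>, some \<open>h\<close> is not eventually dominated by
    any \<open>m\<^sub>x\<close>. From the \<open>n\<close>-th cover it is therefore enough to pick, for each \<open>k \<le> h(n)\<close>, one
    member containing a tail of the column \<open>k\<close>, because any two tails of a column meet.

  \<^item> \<^emph>\<open>Not strongly star-Menger.\<close> Enumerate \<open>L\<close> as \<open>x\<^sub>\<alpha>\<close>, \<open>\<alpha> < \<omega>\<^sub>1\<close>, and cover \<open>X\<close> by the columns
    and by neighbourhoods of \<open>x\<^sub>\<alpha>\<close> that contain no other point of \<open>L\<close> and no point of \<open>\<omega>\<^sub>1 \<times> \<omega>\<close>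
    with first coordinate at most \<open>\<alpha>\<close>. Countably many points are bounded in \<open>\<omega>\<^sub>1\<close>, so they miss
    the only member containing \<open>x\<^sub>\<alpha>\<close> once \<open>\<alpha>\<close> is large.\<close>

section \<open>Countable sets and open covers in \<open>\<omega>\<^sub>1\<close>\<close>

lemma uncountable_omega1: "uncountable (UNIV :: omega1 set)"
proof
  assume "countable (UNIV :: omega1 set)"
  then have "|UNIV :: omega1 set| \<le>o |UNIV :: nat set|"
    by (auto simp: countable_def simp flip: card_of_ordLeq)
  then have "aleph1 \<le>o natLeq"
    using card_of_omega1 card_of_nat ordIso_symmetric ordIso_ordLeq_trans ordLeq_ordIso_trans by blast
  then show False
    using cardSuc_greater[OF natLeq_Card_order] not_ordLess_ordLeq by blast
qed

lemma countable_atMost_omega1: "countable {..a :: omega1}"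
proof -
  have "{..a} = insert a {..<a}"
    by auto
  then show ?thesis
    using countable_lessThan_omega1[of a] by simp
qed

lemma countable_bounded_omega1:
  fixes S :: "omega1 set"
  assumes "countable S"
  obtains b where "\<And>a. a \<in> S \<Longrightarrow> a < b"
proof -
  have "countable (\<Union>a\<in>S. {..a})"
    using assms countable_atMost_omega1 by blast
  then obtain b where "b \<notin> (\<Union>a\<in>S. {..a})"
    using uncountable_omega1 by (metis UNIV_eq_I)
  then show thesis
    using that[of b] by (auto simp: not_le)
qed

lemma incseq_omega1_converges:
  fixes a :: "nat \<Rightarrow> omega1"
  assumes "incseq a"
  obtains \<delta> where "a \<longlonglongrightarrow> \<delta>"
proof -
  have "countable (range a)"
    by simp
  then obtain b where "\<And>c. c \<in> range a \<Longrightarrow> c < b"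
    by (rule countable_bounded_omega1) blast
  then have b: "\<forall>k. a k \<le> b"
    using less_imp_le by blast
  define \<delta> where "\<delta> = (LEAST b. \<forall>k. a k \<le> b)"
  have le: "a k \<le> \<delta>" for k
    using LeastI[of "\<lambda>b. \<forall>k. a k \<le> b", OF b] unfolding \<delta>_def by blast
  have "a \<longlonglongrightarrow> \<delta>"
  proof (rule order_tendstoI)
    fix c assume "c < \<delta>"
    then have "\<not> (\<forall>k. a k \<le> c)"
      unfolding \<delta>_def by (rule not_less_Least)
    then obtain k where "c < a k"
      by (auto simp: not_le)
    then have "\<forall>l\<ge>k. c < a l"
      using assms by (meson incseqD less_le_trans)
    then show "\<forall>\<^sub>F l in sequentially. c < a l"
      using eventually_sequentially by blast
  next
    fix c assume "\<delta> < c"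
    then show "\<forall>\<^sub>F l in sequentially. a l < c"
      using le le_less_trans by (auto intro!: always_eventually)
  qed
  then show thesis by (rule that)
qed

text \<open>The complement of a set \<open>U i\<close> that contains no tail is closed and unbounded. If no member
  contained a tail, a sequence meeting each of the countably many complements cofinally often
  would converge to a point outside every \<open>U i\<close>.\<close>

lemma countable_cover_contains_tail:
  fixes U :: "nat \<Rightarrow> omega1 set"
  assumes op: "\<And>i. open (U i)" and cover: "(\<Union>i. U i) = UNIV"
  obtains i \<gamma> where "{\<gamma><..} \<subseteq> U i"
proof (rule ccontr)
  assume "\<not> thesis"
  then have "\<forall>i \<gamma>. \<exists>\<beta>. \<gamma> < \<beta> \<and> \<beta> \<notin> U i"
    using that by (metis greaterThan_iff subsetI)
  then obtain nxt where nxt: "\<And>i \<gamma>. \<gamma> < nxt i \<gamma>" "\<And>i \<gamma>. nxt i \<gamma> \<notin> U i"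
    by metis
  \<comment> \<open>The pairing function makes the index \<open>fst (prod_decode k)\<close> take every value infinitely often.\<close>
  define a where "a = rec_nat undefined (\<lambda>k. nxt (fst (prod_decode k)))"
  have a_Suc: "a (Suc k) = nxt (fst (prod_decode k)) (a k)" for k
    by (simp add: a_def)
  then have "incseq a"
    using nxt(1) by (simp add: incseq_SucI less_imp_le)
  then obtain \<delta> where \<delta>: "a \<longlonglongrightarrow> \<delta>"
    by (rule incseq_omega1_converges)
  obtain i where "\<delta> \<in> U i"
    using cover by blast
  then have "\<forall>\<^sub>F k in sequentially. a k \<in> U i"
    using \<delta> op topological_tendstoD by blast
  then obtain N where N: "\<And>k. k \<ge> N \<Longrightarrow> a k \<in> U i"
    using eventually_sequentially by metis
  have "N \<le> Suc (prod_encode (i, N))"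
    using le_prod_encode_2[of N i] by simp
  then have "a (Suc (prod_encode (i, N))) \<in> U i"
    by (rule N)
  then show False
    using nxt(2) by (simp add: a_Suc)
qed

lemma open_atMost_omega1: "open {..a :: omega1}"
proof -
  obtain b where "a < b"
    using countable_bounded_omega1[of "{a}"] by auto
  then have succ: "a < (LEAST b. a < b)"
    by (rule LeastI)
  have "{..a} = {..<(LEAST b. a < b)}"
  proof (intro equalityI subsetI)
    show "c \<in> {..<(LEAST b. a < b)}" if "c \<in> {..a}" for c
      using that succ by simp
    show "c \<in> {..a}" if "c \<in> {..<(LEAST b. a < b)}" for c
      using not_less_Least[of c "\<lambda>b. a < b"] that by (simp add: not_less)
  qed
  then show ?thesis
    by simp
qed

text \<open>A half-open interval \<open>{c<..\<beta>}\<close> is clopen, and so is \<open>{\<beta>}\<close> for the least \<open>\<beta>\<close>.\<close>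

lemma clopen_neighbourhood_omega1:
  fixes U :: "omega1 set"
  assumes "open U" "\<beta> \<in> U"
  obtains C where "open C" "closed C" "\<beta> \<in> C" "C \<subseteq> U" "C \<subseteq> {..\<beta>}"
proof (cases "\<exists>y. y < \<beta>")
  case True
  then obtain c where c: "c < \<beta>" "{c<..\<beta>} \<subseteq> U"
    using open_left[OF assms] by blast
  have "open ({c<..} \<inter> {..\<beta>})"
    by (rule open_Int[OF open_greaterThan open_atMost_omega1])
  also have "{c<..} \<inter> {..\<beta>} = {c<..\<beta>}"
    by auto
  finally have "open {c<..\<beta>}" .
  moreover have "closed {c<..\<beta>}"
  proof -
    have "- {c<..\<beta>} = {..c} \<union> {\<beta><..}"
      by auto
    then show ?thesis
      using open_Un[OF open_atMost_omega1 open_greaterThan] by (simp add: closed_def)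
  qed
  moreover have "\<beta> \<in> {c<..\<beta>}" "{c<..\<beta>} \<subseteq> {..\<beta>}"
    using c(1) by auto
  ultimately show thesis
    using that c(2) by blast
next
  case False
  then have "{..\<beta>} = {\<beta>}"
    by (auto simp: order.order_iff_strict)
  then show thesis
    using that[of "{\<beta>}"] open_atMost_omega1[of \<beta>] assms by simp
qed

text \<open>Below \<open>\<alpha>\<close> there are only countably many points, each with a clopen neighbourhood inside some
  \<open>U i\<close>. Enumerating these neighbourhoods and removing from each the earlier ones gives disjoint
  open sets.\<close>

lemma locally_constant_choice_omega1:
  fixes U :: "nat \<Rightarrow> omega1 set"
  assumes op: "\<And>i. open (U i)" and cover: "(\<Union>i. U i) = UNIV" and tail: "{\<alpha><..} \<subseteq> U i"
  obtains \<phi> where "\<And>\<beta>. \<beta> \<in> U (\<phi> \<beta>)" "\<And>\<beta>. \<alpha> < \<beta> \<Longrightarrow> \<phi> \<beta> = i"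
    "\<And>\<beta>. \<exists>W. open W \<and> \<beta> \<in> W \<and> (\<forall>\<gamma>\<in>W. \<phi> \<gamma> = \<phi> \<beta>)"
proof -
  have "\<exists>C j. open C \<and> closed C \<and> \<beta> \<in> C \<and> C \<subseteq> U j \<and> C \<subseteq> {..\<beta>}" for \<beta>
  proof -
    obtain j where "\<beta> \<in> U j"
      using cover by blast
    then show ?thesis
      by (rule clopen_neighbourhood_omega1[OF op]) blast
  qed
  then obtain C j where C: "\<And>\<beta>. open (C \<beta>)" "\<And>\<beta>. closed (C \<beta>)" "\<And>\<beta>. \<beta> \<in> C \<beta>"
    "\<And>\<beta>. C \<beta> \<subseteq> U (j \<beta>)" "\<And>\<beta>. C \<beta> \<subseteq> {..\<beta>}"
    by metis
  define e where "e = from_nat_into {..\<alpha>}"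
  have e: "e k \<le> \<alpha>" for k
    using from_nat_into[of "{..\<alpha>}" k] by (auto simp: e_def)
  have e_surj: "\<exists>k. e k = \<beta>" if "\<beta> \<le> \<alpha>" for \<beta>
    using that from_nat_into_surj[OF countable_atMost_omega1, of \<beta> \<alpha>] by (auto simp: e_def)
  define first where "first \<beta> = (LEAST k. \<beta> \<in> C (e k))" for \<beta>
  have first: "\<beta> \<in> C (e (first \<beta>))" if le: "\<beta> \<le> \<alpha>" for \<beta>
  proof -
    have "\<exists>k. \<beta> \<in> C (e k)"
      using e_surj[OF le] C(3) by metis
    then show ?thesis
      unfolding first_def by (rule LeastI_ex)
  qed
  define \<phi> where "\<phi> \<beta> = (if \<beta> \<le> \<alpha> then j (e (first \<beta>)) else i)" for \<beta>
  show thesis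
  proof (rule that[of \<phi>])
    fix \<beta>
    show "\<beta> \<in> U (\<phi> \<beta>)"
    proof (cases "\<beta> \<le> \<alpha>")
      case True
      then show ?thesis
        using first[OF True] C(4) by (auto simp: \<phi>_def)
    next
      case False
      then show ?thesis
        using tail by (auto simp: \<phi>_def)
    qed
    show "\<phi> \<beta> = i" if "\<alpha> < \<beta>"
      using that by (auto simp: \<phi>_def)
    show "\<exists>W. open W \<and> \<beta> \<in> W \<and> (\<forall>\<gamma>\<in>W. \<phi> \<gamma> = \<phi> \<beta>)"
    proof (cases "\<beta> \<le> \<alpha>")
      case True
      let ?W = "C (e (first \<beta>)) \<inter> (\<Inter>k<first \<beta>. - C (e k))"
      have "open ?W"
        by (intro open_Int C(1) open_INT finite_lessThan ballI open_Compl C(2))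
      moreover have "\<beta> \<notin> C (e k)" if "k < first \<beta>" for k
        using that unfolding first_def by (rule not_less_Least)
      then have "\<beta> \<in> ?W"
        using first[OF True] by simp
      moreover have "\<phi> \<gamma> = \<phi> \<beta>" if "\<gamma> \<in> ?W" for \<gamma>
      proof -
        have "\<gamma> \<le> e (first \<beta>)"
          using that C(5) by blast
        then have "\<gamma> \<le> \<alpha>"
          using e by (rule order_trans)
        moreover have "first \<gamma> = first \<beta>"
          unfolding first_def[of \<gamma>]
        proof (rule Least_equality)
          show "\<gamma> \<in> C (e (first \<beta>))"
            using that by blast
          show "first \<beta> \<le> k" if "\<gamma> \<in> C (e k)" for k
            using that \<open>\<gamma> \<in> ?W\<close> by (meson ComplD INT_iff IntD2 lessThan_iff not_le)
        qed
        ultimately show ?thesis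
          using True by (simp add: \<phi>_def)
      qed
      ultimately show ?thesis
        by blast
    next
      case False
      then show ?thesis
        by (intro exI[of _ "{\<alpha><..}"]) (auto simp: \<phi>_def)
    qed
  qed
qed

text \<open>If no finite set worked, a sequence could avoid at each step the star of its earlier terms.
  It would accumulate at the least point with infinitely many terms at or below it, so a member of
  the cover containing that point would contain two of the terms.\<close>

lemma star_of_finite_set_omega1:
  fixes \<U> :: "omega1 set set"
  assumes op: "\<And>U. U \<in> \<U> \<Longrightarrow> open U" and cover: "\<Union>\<U> = UNIV"
  obtains F where "finite F" "St F \<U> = UNIV"
proof (rule ccontr)
  assume "\<not> thesis"
  then have "\<forall>F. \<exists>\<beta>. finite F \<longrightarrow> \<beta> \<notin> St F \<U>"
    using that by blast
  then obtain pick where pick: "\<And>F. finite F \<Longrightarrow> pick F \<notin> St F \<U>"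
    by metis
  define S where "S = rec_nat {} (\<lambda>_ F. insert (pick F) F)"
  have S_Suc: "S (Suc k) = insert (pick (S k)) (S k)" for k
    by (simp add: S_def)
  have fin: "finite (S k)" for k
    by (induction k) (simp_all add: S_Suc, simp add: S_def)
  define a where "a k = pick (S k)" for k
  have mem: "a k \<in> S l" if "k < l" for k l
    using that by (induction l) (auto simp: S_Suc a_def less_Suc_eq)
  have "countable (range a)"
    by simp
  then obtain b where "\<And>c. c \<in> range a \<Longrightarrow> c < b"
    by (rule countable_bounded_omega1) blast
  then have "{k. a k \<le> b} = UNIV"
    using less_imp_le by blast
  then have ex: "infinite {k. a k \<le> b}"
    by simp
  define \<delta> where "\<delta> = (LEAST b. infinite {k. a k \<le> b})"
  have inf: "infinite {k. a k \<le> \<delta>}"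
    using LeastI[of "\<lambda>b. infinite {k. a k \<le> b}", OF ex] by (simp add: \<delta>_def)
  have least: "finite {k. a k \<le> c}" if "c < \<delta>" for c
    using not_less_Least[of c "\<lambda>b. infinite {k. a k \<le> b}"] that unfolding \<delta>_def by blast
  have "\<delta> \<in> \<Union>\<U>"
    using cover by simp
  then obtain U where U: "U \<in> \<U>" "\<delta> \<in> U"
    by blast
  have "infinite {k. a k \<in> U}"
  proof (cases "\<exists>y. y < \<delta>")
    case True
    then obtain c where c: "c < \<delta>" "{c<..\<delta>} \<subseteq> U"
      using open_left[OF op[OF U(1)] U(2)] by blast
    have "infinite ({k. a k \<le> \<delta>} - {k. a k \<le> c})"
      using inf least[OF c(1)] by simp
    moreover have "{k. a k \<le> \<delta>} - {k. a k \<le> c} \<subseteq> {k. a k \<in> U}"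
      using c(2) by (auto simp: not_le)
    ultimately show ?thesis
      using infinite_super by blast
  next
    case False
    then have "{k. a k \<le> \<delta>} \<subseteq> {k. a k \<in> U}"
      using U(2) by (auto simp: order.order_iff_strict)
    then show ?thesis
      using inf infinite_super by blast
  qed
  then obtain k where k: "a k \<in> U"
    using infinite_imp_nonempty by blast
  obtain l where l: "k < l" "a l \<in> U"
    using \<open>infinite {k. a k \<in> U}\<close> unfolding infinite_nat_iff_unbounded by blast
  then have "a l \<in> St (S l) \<U>"
    using U(1) k mem by (auto simp: St_def)
  then show False
    using pick fin by (simp add: a_def)
qed

section \<open>Products with a compact factor\<close>

text \<open>The disjoint pairs of finite unions of members of a countable base serve: disjoint compact
  sets have disjoint open neighbourhoods, and such a finite union fits between a compact set and
  an open set around it.\<close>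

lemma countable_separating_pairs:
  obtains P Q :: "nat \<Rightarrow> 'b :: {second_countable_topology, metric_space} set"
  where "\<And>i. open (P i)" "\<And>i. open (Q i)" "\<And>i. P i \<inter> Q i = {}"
    and "\<And>S T. compact S \<Longrightarrow> compact T \<Longrightarrow> S \<inter> T = {} \<Longrightarrow> \<exists>i. S \<subseteq> P i \<and> T \<subseteq> Q i"
proof -
  obtain B :: "'b set set" where B: "countable B" "topological_basis B"
    using ex_countable_basis by blast
  define \<F> where "\<F> = {F. finite F \<and> F \<subseteq> B}"
  define \<P> where "\<P> = {(P, Q). P \<in> Union ` \<F> \<and> Q \<in> Union ` \<F> \<and> P \<inter> Q = {}}"
  have "countable \<F>"
    using countable_Collect_finite_subset[OF B(1)] by (simp add: \<F>_def)
  then have cnt: "countable \<P>"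
    by (rule_tac countable_subset[of _ "Union ` \<F> \<times> Union ` \<F>"]) (auto simp: \<P>_def)
  have "({}, {}) \<in> \<P>"
    by (force simp: \<P>_def \<F>_def)
  then have ne: "\<P> \<noteq> {}"
    by blast
  define P Q where "P i = fst (from_nat_into \<P> i)" and "Q i = snd (from_nat_into \<P> i)" for i
  have PQ: "(P i, Q i) \<in> \<P>" for i
    using from_nat_into[OF ne, of i] by (simp add: P_def Q_def)
  have op: "open (\<Union>F)" if "F \<in> \<F>" for F
    using that topological_basis_open[OF B(2)] by (auto simp: \<F>_def)
  have between: "\<exists>F\<in>\<F>. S \<subseteq> \<Union>F \<and> \<Union>F \<subseteq> V" if cpt: "compact S" and V: "open V" "S \<subseteq> V" for S V
  proof -
    obtain B' where "B' \<subseteq> B" "\<Union>B' = V"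
      using B(2) V(1) by (auto simp: topological_basis_def)
    moreover have "open b" if "b \<in> B'" for b
      using that calculation(1) topological_basis_open[OF B(2)] by blast
    ultimately obtain F where "F \<subseteq> B'" "finite F" "S \<subseteq> \<Union>F"
      using compactE[OF cpt, of B'] V(2) by metis
    then show ?thesis
      using \<open>B' \<subseteq> B\<close> \<open>\<Union>B' = V\<close> by (intro bexI[of _ F]) (auto simp: \<F>_def)
  qed
  show thesis
  proof
    show "open (P i)" "open (Q i)" "P i \<inter> Q i = {}" for i
      using PQ[of i] op by (auto simp: \<P>_def)
    fix S T :: "'b set" assume ST: "compact S" "compact T" "S \<inter> T = {}"
    have "compactin euclidean S" "compactin euclidean T" "disjnt S T"
      using ST by (simp_all add: disjnt_def)
    then obtain V W where "openin euclidean V" "openin euclidean W" "S \<subseteq> V" "T \<subseteq> W" "disjnt V W"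
      by (rule Hausdorff_space_compact_separation[OF Hausdorff_space_euclidean])
    note VW = this
    have "open V" "open W"
      using VW(1,2) by (simp_all only: open_openin[symmetric])
    have "V \<inter> W = {}"
      using VW(5) by (simp only: disjnt_def)
    obtain F where F: "F \<in> \<F>" "S \<subseteq> \<Union>F" "\<Union>F \<subseteq> V"
      using between[OF ST(1) \<open>open V\<close> VW(3)] by meson
    obtain G where G: "G \<in> \<F>" "T \<subseteq> \<Union>G" "\<Union>G \<subseteq> W"
      using between[OF ST(2) \<open>open W\<close> VW(4)] by meson
    have "\<Union>F \<inter> \<Union>G = {}"
      using F(3) G(3) \<open>V \<inter> W = {}\<close> by blast
    then have "(\<Union>F, \<Union>G) \<in> \<P>"
      using F(1) G(1) by (simp add: \<P>_def)
    then obtain i where "from_nat_into \<P> i = (\<Union>F, \<Union>G)"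
      using from_nat_into_surj[OF cnt] by blast
    then show "\<exists>i. S \<subseteq> P i \<and> T \<subseteq> Q i"
      using \<open>S \<subseteq> \<Union>F\<close> \<open>T \<subseteq> \<Union>G\<close> by (intro exI[of _ i]) (simp add: P_def Q_def)
  qed
qed

text \<open>Equivalently, every countable open cover has a refinement that partitions the space into
  open sets. The form with an index function is the one in which a choice of indices can be made
  pointwise and then shown to be locally constant.\<close>

definition locally_constant_choices :: "'a topology \<Rightarrow> bool"
  where "locally_constant_choices X \<longleftrightarrow>
    (\<forall>U :: nat \<Rightarrow> 'a set. (\<forall>i. openin X (U i)) \<and> (\<Union>i. U i) = topspace X \<longrightarrow>
      (\<exists>\<Phi>. (\<forall>p\<in>topspace X. p \<in> U (\<Phi> p)) \<and> (\<forall>i. openin X {p \<in> topspace X. \<Phi> p = i})))"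

text \<open>Let \<open>U i\<close> consist of the points over which the \<open>i\<close>-th pair \<open>(P i, Q i)\<close> separates the fibres
  of the two closed sets. It is open because projections along a compact factor are closed. Given
  a locally constant \<open>\<Phi>\<close> choosing an index at each point, the union of the boxes \<open>{\<Phi> = i} \<times> P i\<close>
  is disjoint from that of the boxes \<open>{\<Phi> = i} \<times> Q i\<close>, and these are the required neighbourhoods.\<close>

lemma normal_prod_compact:
  fixes C :: "'b :: {second_countable_topology, metric_space} set"
  assumes X: "locally_constant_choices X" and C: "compact C"
  shows "normal_space (prod_topology X (top_of_set C))"
  unfolding normal_space_def
proof (intro allI impI)
  let ?Y = "prod_topology X (top_of_set C)"
  fix H K :: "('a \<times> 'b) set"
  assume HK: "closedin ?Y H \<and> closedin ?Y K \<and> disjnt H K"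
  then have sub: "H \<subseteq> topspace X \<times> C" "K \<subseteq> topspace X \<times> C"
    using closedin_subset by fastforce+
  have cmap: "closed_map ?Y X fst"
    using C by (simp add: closed_map_fst compact_space_subtopology)
  obtain P Q :: "nat \<Rightarrow> 'b set" where PQ: "\<And>i. open (P i)" "\<And>i. open (Q i)" "\<And>i. P i \<inter> Q i = {}"
    and sep: "\<And>S T. compact S \<Longrightarrow> compact T \<Longrightarrow> S \<inter> T = {} \<Longrightarrow> \<exists>i. S \<subseteq> P i \<and> T \<subseteq> Q i"
    by (rule countable_separating_pairs) blast
  define U where "U i = {x \<in> topspace X. H `` {x} \<subseteq> P i \<and> K `` {x} \<subseteq> Q i}" for i
  have tube: "openin X {x \<in> topspace X. E `` {x} \<subseteq> R}" if "closedin ?Y E" "open R" for E R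
  proof -
    have "closedin ?Y (topspace X \<times> (C - R))"
      using that(2) by (simp add: closedin_prod_Times_iff closedin_subtopology Diff_eq)
        (metis Int_commute closed_Compl)
    then have "closedin X (fst ` (E \<inter> topspace X \<times> (C - R)))"
      using cmap that(1) by (simp add: closed_map_def closedin_Int)
    then have "openin X (topspace X - fst ` (E \<inter> topspace X \<times> (C - R)))"
      by blast
    moreover have "E \<subseteq> topspace X \<times> C"
      using closedin_subset[OF that(1)] by simp
    then have "topspace X - fst ` (E \<inter> topspace X \<times> (C - R)) = {x \<in> topspace X. E `` {x} \<subseteq> R}"
      by force
    ultimately show ?thesis
      by simp
  qed
  have "openin X (U i)" for i
  proof -
    have "U i = {x \<in> topspace X. H `` {x} \<subseteq> P i} \<inter> {x \<in> topspace X. K `` {x} \<subseteq> Q i}"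
      by (auto simp: U_def)
    then show ?thesis
      using tube HK PQ by (simp add: openin_Int)
  qed
  moreover have "(\<Union>i. U i) = topspace X"
  proof -
    have fibre: "compact (E `` {x})" if "closedin ?Y E" "x \<in> topspace X" for E x
    proof -
      have "continuous_map (top_of_set C) ?Y (Pair x)"
        using that(2) by (simp add: continuous_map_pairwise o_def)
      then have "closedin (top_of_set C) {t \<in> topspace (top_of_set C). Pair x t \<in> E}"
        using that(1) by (rule closedin_continuous_map_preimage)
      moreover have "{t \<in> topspace (top_of_set C). Pair x t \<in> E} = E `` {x}"
        using closedin_subset[OF that(1)] by auto
      ultimately show ?thesis
        using C closedin_compact by metis
    qed
    have "\<exists>i. x \<in> U i" if "x \<in> topspace X" for x
      using sep[OF fibre fibre, of H x K x] that HK by (fastforce simp: U_def disjnt_iff)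
    then show ?thesis
      by (auto simp: U_def)
  qed
  ultimately obtain \<Phi> where \<Phi>: "\<And>p. p \<in> topspace X \<Longrightarrow> p \<in> U (\<Phi> p)"
    "\<And>i. openin X {p \<in> topspace X. \<Phi> p = i}"
    using X unfolding locally_constant_choices_def by metis
  define G where "G R = (\<Union>i. {p \<in> topspace X. \<Phi> p = i} \<times> (C \<inter> R i))" for R :: "nat \<Rightarrow> 'b set"
  have G_open: "openin ?Y (G R)" if "\<And>i. open (R i)" for R
    unfolding G_def using \<Phi>(2) that
    by (intro openin_Union) (auto simp: openin_prod_Times_iff openin_open_Int)
  show "\<exists>V W. openin ?Y V \<and> openin ?Y W \<and> H \<subseteq> V \<and> K \<subseteq> W \<and> disjnt V W"
  proof (intro exI conjI)
    show "openin ?Y (G P)" "openin ?Y (G Q)"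
      using PQ by (auto intro: G_open)
    show "H \<subseteq> G P" "K \<subseteq> G Q"
      using sub \<Phi>(1) by (fastforce simp: G_def U_def)+
    show "disjnt (G P) (G Q)"
      using PQ(3) by (fastforce simp: G_def disjnt_iff)
  qed
qed

text \<open>Multiplying by a one-point space changes nothing up to homeomorphism.\<close>

lemma normal_if_locally_constant_choices:
  assumes "locally_constant_choices X"
  shows "normal_space X"
proof -
  have "top_of_set {0 :: real} = discrete_topology {0}"
    by (metis empty_subsetI insert_subset subtopology_eq_discrete_topology_sing subtopology_topspace
        topspace_euclidean_subtopology)
  then have "prod_topology X (top_of_set {0 :: real}) homeomorphic_space X"
    by (rule prod_topology_homeomorphic_space_left)
  then show ?thesis
    using normal_prod_compact[OF assms, of "{0 :: real}"] homeomorphic_normal_space by auto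
qed

section \<open>The space \<open>X\<^sub>0\<close>\<close>

locale coded_subsets =
  fixes L :: "'l set" and \<A> :: "nat set set" and f :: "'l set \<Rightarrow> nat set"
  assumes indep: "strongly_independent \<A>"
    and bij: "bij_betw f (Pow L) (\<A> \<union> uminus ` \<A>)"
    and compl: "\<And>B. B \<subseteq> L \<Longrightarrow> f (L - B) = - f B"
begin

abbreviation "X0 \<equiv> X0_space L f"
abbreviation "X \<equiv> X_space L f"

lemma openin_X0_coded: "M \<subseteq> L \<Longrightarrow> openin X0 (M <+> f M)"
  unfolding X0_space_def by (rule topology_generated_by_Basis) blast

lemma openin_X0_delete: "p \<in> X0_points L \<Longrightarrow> openin X0 (X0_points L - {p})"
  unfolding X0_space_def by (rule topology_generated_by_Basis) blast

text \<open>Each \<open>f M\<close> is a member of the independent family or the complement of one. No member occurs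
  together with its complement, since \<open>f M = - f N = f (L - N)\<close> would make \<open>M\<close> and \<open>N\<close>
  complementary although both contain \<open>x\<close>.\<close>

lemma infinite_inter_coded:
  assumes "finite \<M>" and sub: "\<And>M. M \<in> \<M> \<Longrightarrow> M \<subseteq> L \<and> x \<in> M"
  shows "infinite (\<Inter>M\<in>\<M>. f M)"
proof -
  define F G where "F = f ` \<M> \<inter> \<A>" and "G = uminus ` f ` \<M> \<inter> \<A>"
  have "F \<inter> G = {}"
  proof (rule ccontr)
    assume "F \<inter> G \<noteq> {}"
    then obtain M N where MN: "M \<in> \<M>" "N \<in> \<M>" "f M = - f N"
      by (auto simp: F_def G_def)
    then have "f M = f (L - N)"
      using compl sub by simp
    then have "M = L - N"
      using bij sub MN(1) unfolding bij_betw_def by (meson Diff_subset PowI inj_onD)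
    then show False
      using sub MN by blast
  qed
  then have "infinite (\<Inter>F \<inter> (\<Inter>A\<in>G. - A))"
    using indep assms(1) unfolding strongly_independent_def by (simp add: F_def G_def)
  moreover have "\<Inter>F \<inter> (\<Inter>A\<in>G. - A) \<subseteq> (\<Inter>M\<in>\<M>. f M)"
  proof
    fix n assume n: "n \<in> \<Inter>F \<inter> (\<Inter>A\<in>G. - A)"
    have "n \<in> f M" if M: "M \<in> \<M>" for M
    proof (cases "f M \<in> \<A>")
      case True
      then show ?thesis
        using n M by (auto simp: F_def)
    next
      case False
      moreover have "f M \<in> \<A> \<union> uminus ` \<A>"
        using bij sub[OF M] by (auto simp: bij_betw_def)
      ultimately have "- f M \<in> \<A>"
        by auto
      then have "- f M \<in> G"
        using M by (auto simp: G_def)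
      then show ?thesis
        using n by auto
    qed
    then show "n \<in> (\<Inter>M\<in>\<M>. f M)"
      by blast
  qed
  ultimately show ?thesis
    using infinite_super by blast
qed

text \<open>The trace on \<open>\<omega>\<close> of a neighbourhood of \<open>x\<close> contains, up to finitely many numbers (from the
  subbasic sets \<open>X0 - {p}\<close>), a finite intersection of codes of sets containing \<open>x\<close>.\<close>

lemma X0_neighbourhood_meets_nat:
  assumes "openin X0 U" "Inl x \<in> U" "x \<in> L"
  obtains n where "Inr n \<in> U"
proof -
  have "generate_topology_on ({M <+> f M | M. M \<subseteq> L} \<union> range (\<lambda>n. {Inr n}) \<union>
      {X0_points L - {p} | p. p \<in> X0_points L}) U"
    using assms(1) by (simp add: X0_space_def openin_topology_generated_by_iff)
  then have "Inl x \<in> U \<longrightarrow> (\<exists>\<M> E. finite \<M> \<and> finite E \<and> (\<forall>M\<in>\<M>. M \<subseteq> L \<and> x \<in> M) \<and>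
      (\<Inter>M\<in>\<M>. f M) - E \<subseteq> Inr -` U)"
  proof induction
    case Empty
    then show ?case by simp
  next
    case (Int A B)
    show ?case
    proof
      assume "Inl x \<in> A \<inter> B"
      then have A: "Inl x \<in> A" and B: "Inl x \<in> B"
        by auto
      obtain \<M> E where "finite \<M>" "finite E" "\<forall>M\<in>\<M>. M \<subseteq> L \<and> x \<in> M"
        "(\<Inter>M\<in>\<M>. f M) - E \<subseteq> Inr -` A"
        using mp[OF Int.IH(1) A] by auto
      moreover obtain \<N> E' where "finite \<N>" "finite E'" "\<forall>M\<in>\<N>. M \<subseteq> L \<and> x \<in> M"
        "(\<Inter>M\<in>\<N>. f M) - E' \<subseteq> Inr -` B"
        using mp[OF Int.IH(2) B] by auto
      ultimately show "\<exists>\<M> E. finite \<M> \<and> finite E \<and> (\<forall>M\<in>\<M>. M \<subseteq> L \<and> x \<in> M) \<and>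
          (\<Inter>M\<in>\<M>. f M) - E \<subseteq> Inr -` (A \<inter> B)"
        by (intro exI[of _ "\<M> \<union> \<N>"] exI[of _ "E \<union> E'"]) auto
    qed
  next
    case (UN K)
    show ?case
    proof
      assume "Inl x \<in> \<Union>K"
      then obtain k where "k \<in> K" "Inl x \<in> k"
        by blast
      then show "\<exists>\<M> E. finite \<M> \<and> finite E \<and> (\<forall>M\<in>\<M>. M \<subseteq> L \<and> x \<in> M) \<and>
          (\<Inter>M\<in>\<M>. f M) - E \<subseteq> Inr -` \<Union>K"
        using UN.IH[of k] by (meson Union_upper subset_trans vimage_mono)
    qed
  next
    case (Basis s)
    then consider M where "s = M <+> f M" "M \<subseteq> L" | n where "s = {Inr n}"
      | p where "s = X0_points L - {p}"
      by blast
    then show ?case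
    proof cases
      case 1
      then show ?thesis
        by (intro impI exI[of _ "{M}"] exI[of _ "{}"]) auto
    next
      case 2
      then show ?thesis by simp
    next
      case 3
      have "finite {n. p = Inr n}"
        by (cases p) auto
      then show ?thesis
        by (intro impI exI[of _ "{}"] exI[of _ "{n. p = Inr n}"]) (auto simp: 3 X0_points_def)
    qed
  qed
  then obtain \<M> E where "finite \<M>" "finite E" "\<forall>M\<in>\<M>. M \<subseteq> L \<and> x \<in> M"
    "(\<Inter>M\<in>\<M>. f M) - E \<subseteq> Inr -` U"
    using assms(2) by blast
  moreover have "infinite ((\<Inter>M\<in>\<M>. f M) - E)"
    using infinite_inter_coded[of \<M> x] calculation by simp
  then obtain n where "n \<in> (\<Inter>M\<in>\<M>. f M) - E"
    using infinite_imp_nonempty by (metis ex_in_conv)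
  ultimately have "Inr n \<in> U"
    by blast
  then show thesis
    by (rule that)
qed

text \<open>If \<open>M i\<close> is the set where \<open>g\<close> is \<open>i\<close>, then \<open>M i \<union> f (M i)\<close> is clopen in \<open>X0\<close>. These sets may
  overlap inside \<open>\<omega>\<close>, so \<open>h n\<close> is the first \<open>i\<close> with \<open>n \<in> f (M i)\<close>; only finitely many earlier
  sets have to be avoided near a point. Numbers \<open>n\<close> in no \<open>f (M i)\<close> get an arbitrary value.\<close>

lemma extend_partition_to_X0:
  fixes g :: "'l \<Rightarrow> nat"
  shows "\<exists>h. \<forall>x\<in>L. \<exists>U. openin X0 U \<and> Inl x \<in> U \<and>
    (\<forall>y. Inl y \<in> U \<longrightarrow> g y = g x) \<and> (\<forall>n. Inr n \<in> U \<longrightarrow> h n = g x)"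
proof -
  define M where "M i = {x \<in> L. g x = i}" for i
  define h where "h n = (LEAST i. n \<in> f (M i))" for n
  show ?thesis
  proof (intro exI[of _ h] ballI)
    fix x assume x: "x \<in> L"
    define N where "N k = (if k = g x then M k else L - M k)" for k
    have N_sub: "N k \<subseteq> L" for k
      by (auto simp: N_def M_def)
    define U where "U = (\<Inter>k\<in>{..g x}. N k <+> f (N k))"
    have "openin X0 U"
      unfolding U_def using openin_X0_coded[OF N_sub] by (intro openin_INT2) auto
    moreover have "Inl x \<in> U"
      using x by (auto simp: U_def N_def M_def)
    moreover have "g y = g x" if "Inl y \<in> U" for y
      using that by (force simp: U_def N_def M_def)
    moreover have "h n = g x" if "Inr n \<in> U" for n
    proof -
      have n: "n \<in> f (N k)" if "k \<le> g x" for k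
        using that \<open>Inr n \<in> U\<close> by (auto simp: U_def)
      have "n \<notin> f (M k)" if "k < g x" for k
        using n[of k] that compl[of "M k"] by (auto simp: N_def M_def)
      moreover have "n \<in> f (M (g x))"
        using n[of "g x"] by (simp add: N_def)
      ultimately show ?thesis
        unfolding h_def by (metis (mono_tags, lifting) Least_equality not_le)
    qed
    ultimately show "\<exists>U. openin X0 U \<and> Inl x \<in> U \<and>
        (\<forall>y. Inl y \<in> U \<longrightarrow> g y = g x) \<and> (\<forall>n. Inr n \<in> U \<longrightarrow> h n = g x)"
      by blast
  qed
qed

section \<open>Normality\<close>

lemma openin_column:
  assumes "openin X U"
  shows "open {\<beta>. Inr (\<beta>, n) \<in> U}"
proof (subst open_subopen, intro ballI)
  fix \<beta> assume "\<beta> \<in> {\<beta>. Inr (\<beta>, n) \<in> U}"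
  then obtain W where "open W" "\<beta> \<in> W" "Inr ` (W \<times> {n}) \<subseteq> U"
    using assms openin_X_space_iff[of L f U] by blast
  then show "\<exists>W. open W \<and> \<beta> \<in> W \<and> W \<subseteq> {\<beta>. Inr (\<beta>, n) \<in> U}"
    by blast
qed

lemma t1_space_X: "t1_space X"
proof -
  have "openin X ((L <+> UNIV) - {p})" for p
    unfolding openin_X_space_iff
  proof (intro conjI ballI allI impI)
    fix x assume "x \<in> L" and x: "Inl x \<in> (L <+> UNIV) - {p}"
    define q where "q = map_sum id snd p"
    show "\<exists>U \<alpha>. openin X0 U \<and> Inl x \<in> U \<and> L_nbhd U \<alpha> \<subseteq> (L <+> UNIV) - {p}"
    proof (cases "q \<in> X0_points L")
      case True
      show ?thesis
      proof (intro exI conjI)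
        show "openin X0 (X0_points L - {q})"
          by (rule openin_X0_delete[OF True])
        show "Inl x \<in> X0_points L - {q}"
          using x \<open>x \<in> L\<close> by (cases p) (auto simp: q_def X0_points_def)
        show "L_nbhd (X0_points L - {q}) undefined \<subseteq> (L <+> UNIV) - {p}"
          by (cases p) (auto simp: L_nbhd_def q_def X0_points_def)
      qed
    next
      case False
      show ?thesis
      proof (intro exI conjI)
        show "openin X0 (X0_points L)"
          using openin_topspace[of X0] by (simp add: topspace_X0_space)
        show "Inl x \<in> X0_points L"
          using \<open>x \<in> L\<close> by (auto simp: X0_points_def)
        show "L_nbhd (X0_points L) undefined \<subseteq> (L <+> UNIV) - {p}"
          using False by (cases p) (auto simp: L_nbhd_def q_def X0_points_def)
      qed
    qed
  next
    fix \<alpha> n assume "Inr (\<alpha>, n) \<in> (L <+> UNIV) - {p}"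
    then show "\<exists>W. open W \<and> \<alpha> \<in> W \<and> Inr ` (W \<times> {n}) \<subseteq> (L <+> UNIV) - {p}"
    proof (intro exI conjI)
      have "{\<beta>. p = Inr (\<beta>, n)} \<subseteq> {fst (projr p)}"
        by auto
      then have "finite {\<beta>. p = Inr (\<beta>, n)}"
        by (rule finite_subset) simp
      then show "open (- {\<beta>. p = Inr (\<beta>, n)})"
        by (intro open_Compl finite_imp_closed)
    qed auto
  qed auto
  then show ?thesis
    unfolding t1_space_def topspace_X_space by (metis DiffD2 DiffI empty_iff insert_iff)
qed

text \<open>A choice of indices on \<open>L\<close> extends to a neighbourhood of \<open>L\<close> in \<open>X0\<close> and thus prescribes an
  index for the tails of the columns near \<open>L\<close>. The tails can all start at the same \<open>\<alpha>\<close>, as there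
  are only countably many columns. Below \<open>\<alpha>\<close> no point is near \<open>L\<close>, and each column is treated
  separately.\<close>

lemma locally_constant_choices_X: "locally_constant_choices X"
  unfolding locally_constant_choices_def
proof (intro allI impI)
  fix U :: "nat \<Rightarrow> ('l + omega1 \<times> nat) set"
  assume U: "(\<forall>i. openin X (U i)) \<and> (\<Union>i. U i) = topspace X"
  then have op: "openin X (U i)" for i
    by blast
  have "\<exists>i. Inl x \<in> U i" if "x \<in> L" for x
    using U that by (auto simp: topspace_X_space)
  then obtain g where g: "\<And>x. x \<in> L \<Longrightarrow> Inl x \<in> U (g x)"
    by metis
  obtain h where h: "\<forall>x\<in>L. \<exists>V. openin X0 V \<and> Inl x \<in> V \<and>
    (\<forall>y. Inl y \<in> V \<longrightarrow> g y = g x) \<and> (\<forall>n. Inr n \<in> V \<longrightarrow> h n = g x)"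
    by (rule exE[OF extend_partition_to_X0])
  define col where "col n i = {\<beta>. Inr (\<beta>, n) \<in> U i}" for n i
  have col_open: "open (col n i)" for n i
    unfolding col_def by (rule openin_column[OF op])
  have "(\<Union>i. U i) = L <+> UNIV"
    using U by (simp add: topspace_X_space)
  then have "\<exists>i. Inr (\<beta>, n) \<in> U i" for \<beta> n
    by (metis InrI UNIV_I UN_iff)
  then have col_cover: "(\<Union>i. col n i) = UNIV" for n
    by (auto simp: col_def)
  \<comment> \<open>If a tail of the column lies in the set with the index prescribed by \<open>h\<close>, that index is
    kept: this happens for all columns that are close to a point of \<open>L\<close>. For the other columns any index
    of a set that contains a tail will do.\<close>
  have "\<exists>i \<gamma>. {\<gamma><..} \<subseteq> col n i \<and> ((\<exists>\<gamma>'. {\<gamma>'<..} \<subseteq> col n (h n)) \<longrightarrow> i = h n)" for n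
    using countable_cover_contains_tail[OF col_open col_cover, of n] by metis
  then obtain k \<gamma> where tail: "\<And>n. {\<gamma> n<..} \<subseteq> col n (k n)"
    and k: "\<And>n \<gamma>'. {\<gamma>'<..} \<subseteq> col n (h n) \<Longrightarrow> k n = h n"
    by metis
  have "countable (range \<gamma>)"
    by simp
  then obtain \<alpha> where \<alpha>: "\<And>a. a \<in> range \<gamma> \<Longrightarrow> a < \<alpha>"
    by (rule countable_bounded_omega1) blast
  have "{\<alpha><..} \<subseteq> col n (k n)" for n
  proof -
    have "{\<alpha><..} \<subseteq> {\<gamma> n<..}"
      using \<alpha>[of "\<gamma> n"] less_trans by auto
    then show ?thesis
      using tail by (rule order_trans)
  qed
  then have "\<exists>\<phi>. (\<forall>\<beta>. \<beta> \<in> col n (\<phi> \<beta>)) \<and> (\<forall>\<beta>>\<alpha>. \<phi> \<beta> = k n) \<and>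
      (\<forall>\<beta>. \<exists>W. open W \<and> \<beta> \<in> W \<and> (\<forall>\<gamma>\<in>W. \<phi> \<gamma> = \<phi> \<beta>))" for n
    using locally_constant_choice_omega1[OF col_open col_cover, of \<alpha> n "k n"] by metis
  then obtain \<phi> where \<phi>: "\<And>n \<beta>. \<beta> \<in> col n (\<phi> n \<beta>)" "\<And>n \<beta>. \<alpha> < \<beta> \<Longrightarrow> \<phi> n \<beta> = k n"
    "\<And>n \<beta>. \<exists>W. open W \<and> \<beta> \<in> W \<and> (\<forall>\<gamma>\<in>W. \<phi> n \<gamma> = \<phi> n \<beta>)"
    by metis
  define \<Phi> where "\<Phi> = case_sum g (\<lambda>(\<beta>, n). \<phi> n \<beta>)"
  show "\<exists>\<Phi>. (\<forall>p\<in>topspace X. p \<in> U (\<Phi> p)) \<and> (\<forall>i. openin X {p \<in> topspace X. \<Phi> p = i})"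
  proof (intro exI[of _ \<Phi>] conjI ballI allI)
    fix p assume "p \<in> topspace X"
    then show "p \<in> U (\<Phi> p)"
      using g \<phi>(1) by (auto simp: \<Phi>_def topspace_X_space col_def)
  next
    fix i
    show "openin X {p \<in> topspace X. \<Phi> p = i}"
      unfolding openin_X_space_iff
    proof (intro conjI ballI allI impI)
      show "{p \<in> topspace X. \<Phi> p = i} \<subseteq> L <+> UNIV"
        by (auto simp: topspace_X_space)
    next
      fix x assume "x \<in> L" and "Inl x \<in> {p \<in> topspace X. \<Phi> p = i}"
      then have "g x = i"
        by (simp add: \<Phi>_def)
      obtain V where V: "openin X0 V" "Inl x \<in> V" "\<And>y. Inl y \<in> V \<Longrightarrow> g y = i"
        "\<And>n. Inr n \<in> V \<Longrightarrow> h n = i"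
        using bspec[OF h \<open>x \<in> L\<close>] \<open>g x = i\<close> by metis
      obtain V' \<alpha>' where V': "openin X0 V'" "Inl x \<in> V'" "L_nbhd V' \<alpha>' \<subseteq> U i"
        using op[of i] g[OF \<open>x \<in> L\<close>] \<open>x \<in> L\<close> unfolding openin_X_space_iff \<open>g x = i\<close> by metis
      have "k n = i" if "Inr n \<in> V \<inter> V'" for n
      proof -
        have "{\<alpha>'<..} \<subseteq> col n (h n)"
          using that V(4) V'(3) by (auto simp: L_nbhd_def col_def)
        then show ?thesis
          using k V(4) that by auto
      qed
      moreover have "y \<in> L" if "Inl y \<in> V" for y
        using openin_subset[OF V(1)] that by (auto simp: topspace_X0_space X0_points_def)
      ultimately have "L_nbhd (V \<inter> V') \<alpha> \<subseteq> {p \<in> topspace X. \<Phi> p = i}"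
        using V(3) \<phi>(2) by (auto simp: L_nbhd_def \<Phi>_def topspace_X_space)
      then show "\<exists>V \<alpha>. openin X0 V \<and> Inl x \<in> V \<and> L_nbhd V \<alpha> \<subseteq> {p \<in> topspace X. \<Phi> p = i}"
        using V V' openin_Int by blast
    next
      fix \<beta> n assume "Inr (\<beta>, n) \<in> {p \<in> topspace X. \<Phi> p = i}"
      then have "\<phi> n \<beta> = i"
        by (simp add: \<Phi>_def)
      then show "\<exists>W. open W \<and> \<beta> \<in> W \<and> Inr ` (W \<times> {n}) \<subseteq> {p \<in> topspace X. \<Phi> p = i}"
      proof -
        obtain W where W: "open W" "\<beta> \<in> W" "\<And>\<gamma>. \<gamma> \<in> W \<Longrightarrow> \<phi> n \<gamma> = i"
          using \<phi>(3)[where n = n and \<beta> = \<beta>] \<open>\<phi> n \<beta> = i\<close> by metis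
        then have "Inr ` (W \<times> {n}) \<subseteq> {p \<in> topspace X. \<Phi> p = i}"
          by (auto simp: \<Phi>_def topspace_X_space)
        then show ?thesis
          using W by blast
      qed
    qed
  qed
qed

lemma normal_T1_X: "normal_T1_space X"
  unfolding normal_T1_space_def
  using normal_if_locally_constant_choices[OF locally_constant_choices_X] t1_space_X by blast

lemma not_Dowker_X: "\<not> Dowker_space X"
proof -
  have "t1_space (top_of_set {0..1 :: real})"
    by (simp add: Hausdorff_imp_t1_space Hausdorff_space_subtopology)
  then have "normal_T1_space (prod_topology X (top_of_set {0..1 :: real}))"
    unfolding normal_T1_space_def
    using normal_prod_compact[OF locally_constant_choices_X compact_Icc] t1_space_X
    by (simp add: t1_space_prod_topology)
  then show ?thesis
    by (simp add: Dowker_space_def)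
qed

section \<open>Star covering properties\<close>

text \<open>The \<open>n\<close>-th finite family is \<open>\<C> n \<union> \<T> n\<close>: the star of \<open>\<C> n\<close> contains the column \<open>n\<close>, and \<open>\<T>
  n\<close> has for each column \<open>k \<le> h n\<close> a member containing a tail of it, whenever the \<open>n\<close>-th cover has
  one. A point \<open>x \<in> L\<close> lies in the star of \<open>\<T> n\<close> as soon as \<open>m x n \<le> h n\<close>. The family of all \<open>m x\<close>
  is too small to be dominating, which provides an \<open>h\<close> for which each \<open>x\<close> has such an \<open>n\<close>.\<close>

lemma star_Menger_X:
  assumes card: "|L| <o \<dd>"
  shows "star_Menger X"
  unfolding star_Menger_def
proof (intro allI impI)
  fix \<U> :: "nat \<Rightarrow> ('l + omega1 \<times> nat) set set"
  assume cov: "\<forall>n. open_cover X (\<U> n)"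
  have op: "openin X U" if "U \<in> \<U> n" for U n
    using cov that by (auto simp: open_cover_def)
  have cover: "\<exists>U\<in>\<U> n. p \<in> U" if "p \<in> L <+> UNIV" for p n
  proof -
    have "\<Union>(\<U> n) = L <+> UNIV"
      using cov by (simp add: open_cover_def topspace_X_space)
    then show ?thesis
      using that by (metis UnionE)
  qed
  have "\<exists>\<V>. finite \<V> \<and> \<V> \<subseteq> \<U> n \<and> (\<forall>\<beta>. Inr (\<beta>, n) \<in> St (\<Union>\<V>) (\<U> n))" for n
  proof -
    let ?C = "(\<lambda>U. {\<beta>. Inr (\<beta>, n) \<in> U}) ` \<U> n"
    have "open W" if "W \<in> ?C" for W
      using that op openin_column by blast
    moreover have "\<Union>?C = UNIV"
    proof -
      have "\<exists>U\<in>\<U> n. Inr (\<beta>, n) \<in> U" for \<beta>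
        by (rule cover) (rule InrI, rule UNIV_I)
      then show ?thesis
        by auto
    qed
    ultimately obtain F where F: "finite F" "St F ?C = UNIV"
      by (rule star_of_finite_set_omega1)
    have "\<forall>\<beta>. \<exists>U\<in>\<U> n. Inr (\<beta>, n) \<in> U"
      using cover[OF InrI[OF UNIV_I]] by blast
    then obtain u where u: "\<And>\<beta>. u \<beta> \<in> \<U> n" "\<And>\<beta>. Inr (\<beta>, n) \<in> u \<beta>"
      by metis
    have "Inr (\<beta>, n) \<in> St (\<Union>(u ` F)) (\<U> n)" for \<beta>
    proof -
      have "\<beta> \<in> St F ?C"
        using F(2) by simp
      then obtain U \<gamma> where "U \<in> \<U> n" "Inr (\<beta>, n) \<in> U" "Inr (\<gamma>, n) \<in> U" "\<gamma> \<in> F"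
        by (auto simp: St_def)
      then show ?thesis
        using u(2)[of \<gamma>] by (auto simp: St_def)
    qed
    then show ?thesis
      using F(1) u(1) by (intro exI[of _ "u ` F"]) auto
  qed
  then obtain \<C> where \<C>: "\<And>n. finite (\<C> n)" "\<And>n. \<C> n \<subseteq> \<U> n"
    "\<And>n \<beta>. Inr (\<beta>, n) \<in> St (\<Union>(\<C> n)) (\<U> n)"
    by metis
  define tail_in where "tail_in m U \<longleftrightarrow> (\<exists>\<alpha>. Inr ` ({\<alpha><..} \<times> {m}) \<subseteq> U)"
    for m :: nat and U :: "('l + omega1 \<times> nat) set"
  have tails_meet: "U \<inter> V \<noteq> {}" if U: "tail_in m U" and V: "tail_in m V" for m U V
  proof -
    obtain \<alpha> \<beta> where *: "Inr ` ({\<alpha><..} \<times> {m}) \<subseteq> U" "Inr ` ({\<beta><..} \<times> {m}) \<subseteq> V"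
      using U V unfolding tail_in_def by blast
    obtain b where b: "max \<alpha> \<beta> < b"
      using countable_bounded_omega1[of "{max \<alpha> \<beta>}"] by auto
    then have "Inr (b, m) \<in> U \<inter> V"
      using * by auto
    then show ?thesis
      by blast
  qed
  have "\<exists>m. \<exists>U\<in>\<U> n. Inl x \<in> U \<and> tail_in m U" if x: "x \<in> L" for x n
  proof -
    obtain U where U: "U \<in> \<U> n" "Inl x \<in> U"
      using cover[of "Inl x"] x by auto
    then obtain V \<alpha> where V: "openin X0 V" "Inl x \<in> V" "L_nbhd V \<alpha> \<subseteq> U"
      using op[OF U(1)] x unfolding openin_X_space_iff by blast
    obtain m where "Inr m \<in> V"
      by (rule X0_neighbourhood_meets_nat[OF V(1,2) x])
    then have "Inr ` ({\<alpha><..} \<times> {m}) \<subseteq> L_nbhd V \<alpha>"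
      by (auto simp: L_nbhd_def)
    then have "tail_in m U"
      using V(3) unfolding tail_in_def by blast
    then show ?thesis
      using U by blast
  qed
  then obtain m where m: "\<And>x n. x \<in> L \<Longrightarrow> \<exists>U\<in>\<U> n. Inl x \<in> U \<and> tail_in (m x n) U"
    by metis
  obtain h where h: "\<And>x. x \<in> L \<Longrightarrow> \<not> h \<le>\<^sup>* m x"
  proof -
    have "\<not> dominating (m ` L)"
    proof
      assume "dominating (m ` L)"
      then have "\<dd> \<le>o |m ` L|"
        by (metis dominating_number)
      then have "\<dd> \<le>o |L|"
        using card_of_image ordLeq_transitive by blast
      then show False
        using card not_ordLess_ordLeq by blast
    qed
    then show thesis
      using that by (auto simp: dominating_def)
  qed
  define T where "T n k = (SOME U. U \<in> \<U> n \<and> tail_in k U)" for n k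
  have T: "T n k \<in> \<U> n \<and> tail_in k (T n k)" if U: "\<exists>U\<in>\<U> n. tail_in k U" for n k
  proof -
    have "\<exists>U. U \<in> \<U> n \<and> tail_in k U"
      using U by metis
    then show ?thesis
      unfolding T_def by (rule someI_ex)
  qed
  define \<T> where "\<T> n = T n ` {k \<in> {..h n}. \<exists>U\<in>\<U> n. tail_in k U}" for n
  have "finite (\<T> n)" for n
    by (simp add: \<T>_def)
  moreover have "\<T> n \<subseteq> \<U> n" for n
    unfolding \<T>_def using T by (intro image_subsetI) simp
  ultimately have fin: "finite (\<C> n \<union> \<T> n) \<and> \<C> n \<union> \<T> n \<subseteq> \<U> n" for n
    using \<C>(1,2) by simp
  have L_covered: "\<exists>n. Inl x \<in> St (\<Union>(\<T> n)) (\<U> n)" if x: "x \<in> L" for x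
  proof -
    have "{n. \<not> h n \<le> m x n} \<noteq> {}"
      using h[OF x] unfolding le_star_def by (metis finite.emptyI)
    then obtain n where "\<not> h n \<le> m x n"
      by auto
    then have n: "m x n \<le> h n"
      by simp
    obtain U where U: "U \<in> \<U> n" "Inl x \<in> U" "tail_in (m x n) U"
      using m[OF x] by metis
    then have *: "\<exists>U\<in>\<U> n. tail_in (m x n) U"
      by metis
    then have "T n (m x n) \<in> \<T> n"
      unfolding \<T>_def using n by (intro imageI) simp
    then have "T n (m x n) \<subseteq> \<Union>(\<T> n)"
      by (rule Union_upper)
    moreover have "U \<inter> T n (m x n) \<noteq> {}"
      using tails_meet[OF U(3)] T[OF *] by metis
    ultimately have "U \<inter> \<Union>(\<T> n) \<noteq> {}"
      by (metis Int_mono order_refl subset_empty)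
    then have "Inl x \<in> St (\<Union>(\<T> n)) (\<U> n)"
      unfolding St_def using U(1,2) by simp metis
    then show ?thesis
      by metis
  qed
  have mono: "St (\<Union>A) (\<U> n) \<subseteq> St (\<Union>B) (\<U> n)" if "A \<subseteq> B" for A B n
    using Union_mono[OF that] unfolding St_def by (intro Union_mono) auto
  have "(\<Union>n. St (\<Union>(\<C> n \<union> \<T> n)) (\<U> n)) = topspace X"
  proof
    have "U \<subseteq> topspace X" if "U \<in> \<U> n" for U n
      using op[OF that] by (rule openin_subset)
    then have "St A (\<U> n) \<subseteq> topspace X" for A n
      unfolding St_def by (intro Union_least) (metis (mono_tags, lifting) mem_Collect_eq)
    then show "(\<Union>n. St (\<Union>(\<C> n \<union> \<T> n)) (\<U> n)) \<subseteq> topspace X"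
      by (intro UN_least)
    show "topspace X \<subseteq> (\<Union>n. St (\<Union>(\<C> n \<union> \<T> n)) (\<U> n))"
    proof
      fix p assume "p \<in> topspace X"
      then consider x where "x \<in> L" "p = Inl x" | \<beta> n where "p = Inr (\<beta>, n)"
        by (auto simp: topspace_X_space)
      then have "\<exists>n. p \<in> St (\<Union>(\<C> n \<union> \<T> n)) (\<U> n)"
      proof cases
        case 1
        then show ?thesis
          using L_covered mono[OF Un_upper2] by (meson subsetD)
      next
        case 2
        then show ?thesis
          using \<C>(3) mono[OF Un_upper1] by (meson subsetD)
      qed
      then show "p \<in> (\<Union>n. St (\<Union>(\<C> n \<union> \<T> n)) (\<U> n))"
        by simp
    qed
  qed
  then show "\<exists>\<V>. (\<forall>n. finite (\<V> n) \<and> \<V> n \<subseteq> \<U> n) \<and> (\<Union>n. St (\<Union>(\<V> n)) (\<U> n)) = topspace X"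
    using fin by (intro exI[of _ "\<lambda>n. \<C> n \<union> \<T> n"]) simp
qed

text \<open>One cover is used at every stage: the columns and, for \<open>x \<in> L\<close> with index \<open>r x < \<omega>\<^sub>1\<close>, the
  neighbourhood of \<open>x\<close> coded by \<open>f {x}\<close> and cut off at \<open>r x\<close>.\<close>

lemma not_strongly_star_Menger_X:
  assumes card: "|L| =o aleph1"
  shows "\<not> strongly_star_Menger X"
proof
  assume SSM: "strongly_star_Menger X"
  have "|L| =o |UNIV :: omega1 set|"
    using card card_of_omega1 ordIso_symmetric ordIso_transitive by blast
  then obtain r :: "'l \<Rightarrow> omega1" where r: "bij_betw r L UNIV"
    using card_of_ordIso by blast
  define nb where "nb x = L_nbhd ({x} <+> f {x}) (r x)" for x
  define \<U> where "\<U> = nb ` L \<union> range (\<lambda>n. Inr ` (UNIV \<times> {n}))"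
  have "openin X U" if "U \<in> \<U>" for U
  proof -
    have "openin X (nb x)" if "x \<in> L" for x
      unfolding X_space_def nb_def using that openin_X0_coded[of "{x}"]
      by (intro topology_generated_by_Basis) blast
    moreover have "openin X (Inr ` (UNIV \<times> {n}))" for n
      unfolding X_space_def by (intro topology_generated_by_Basis) blast
    ultimately show ?thesis
      using that by (auto simp: \<U>_def)
  qed
  moreover have "\<Union>\<U> = topspace X"
  proof
    show "\<Union>\<U> \<subseteq> topspace X"
      using calculation openin_subset by blast
    show "topspace X \<subseteq> \<Union>\<U>"
    proof
      fix p assume "p \<in> topspace X"
      then consider x where "x \<in> L" "p = Inl x" | \<beta> n where "p = Inr (\<beta>, n)"
        by (auto simp: topspace_X_space)
      then show "p \<in> \<Union>\<U>"
      proof cases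
        case 1
        then have "p \<in> nb x"
          by (auto simp: nb_def L_nbhd_def)
        then show ?thesis
          using 1 by (auto simp: \<U>_def)
      next
        case 2
        then show ?thesis
          by (auto simp: \<U>_def)
      qed
    qed
  qed
  ultimately have "open_cover X \<U>"
    by (auto simp: open_cover_def)
  then have "\<exists>F. (\<forall>n :: nat. finite (F n) \<and> F n \<subseteq> topspace X) \<and> (\<Union>n. St (F n) \<U>) = topspace X"
    using SSM[unfolded strongly_star_Menger_def, rule_format, of "\<lambda>_. \<U>"] by simp
  then obtain F where F: "\<forall>n :: nat. finite (F n) \<and> F n \<subseteq> topspace X" "(\<Union>n. St (F n) \<U>) = topspace X"
    by (elim exE conjE)
  \<comment> \<open>The \<open>\<omega>\<^sub>1\<close>-coordinate of a point, a point of \<open>L\<close> being placed at its index.\<close>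
  define height where "height = case_sum r (fst :: omega1 \<times> nat \<Rightarrow> omega1)"
  have "countable (height ` (\<Union>n. F n))"
    using F(1) by (simp add: countable_finite)
  then obtain b where b: "\<And>a. a \<in> height ` (\<Union>n. F n) \<Longrightarrow> a < b"
    by (rule countable_bounded_omega1) blast
  obtain x where x: "x \<in> L" "r x = b"
    using r by (metis UNIV_I bij_betw_imp_surj_on imageE)
  have "Inl x \<in> (\<Union>n. St (F n) \<U>)"
    unfolding F(2) topspace_X_space using x(1) by (rule InlI)
  then obtain n U where U: "U \<in> \<U>" "Inl x \<in> U" "U \<inter> F n \<noteq> {}"
    by (auto simp: St_def)
  then have "U = nb x"
    by (auto simp: \<U>_def nb_def L_nbhd_def)
  then obtain p where p: "p \<in> nb x" "p \<in> F n"
    using U(3) by blast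
  then have "b \<le> height p"
    using x(2) by (auto simp: nb_def L_nbhd_def height_def)
  moreover have "height p < b"
    using p(2) by (intro b) blast
  ultimately show False
    by simp
qed

end

theorem proposition5p5:
  fixes L :: "'l set" and \<A> :: "nat set set" and f :: "'l set \<Rightarrow> nat set"
  assumes "ctwo ^c natLeq =o ctwo ^c aleph1"
    and "aleph1 <o \<dd>"
    and "|L| =o aleph1"
    and "strongly_independent \<A>"
    and "|\<A>| =o ctwo ^c natLeq"
    and "bij_betw f (Pow L) (\<A> \<union> uminus ` \<A>)"
    and "\<And>B. B \<subseteq> L \<Longrightarrow> f (L - B) = - f B"
  shows "normal_T1_space (X_space L f) \<and> star_Menger (X_space L f) \<and>
    \<not> strongly_star_Menger (X_space L f) \<and> \<not> Dowker_space (X_space L f)"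
proof -
  interpret coded_subsets L \<A> f
    using assms(4,6,7) by unfold_locales
  show ?thesis
    using normal_T1_X star_Menger_X[OF ordIso_ordLess_trans[OF assms(3,2)]]
      not_strongly_star_Menger_X[OF assms(3)] not_Dowker_X by blast
qed

end
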